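(* Let $A$ be a unital $C^*$-algebra and $B\subseteq A$ a $C^*$-subalgebra with $1_A\in B$, and let $m\ge1$. Let $\sigma:\mathbb{Z}^m\to\mathrm{Aut}\big(\bigotimes_{\mathbb{Z}^m}A\big)$ be the Bernoulli action. Then $\dim_{\mathrm{Rok}}(\sigma)\le\dim_{\mathrm{Rok}}\big(\sigma|_{\bigotimes_{\mathbb{Z}^m}B}\big)$.
   Context: All tensor products are minimal. For a unital $C^*$-algebra $A$ and a discrete group $\Gamma$, $\bigotimes_\Gamma A$ is the inductive limit of $\{\bigotimes_F A:F\subseteq\Gamma\text{ finite}\}$ with the natural inclusions (tensoring with units) as connecting maps. The left translation action of $\Gamma$ on itself induces the Bernoulli action $\sigma:\Gamma\to\mathrm{Aut}(\bigotimes_\Gamma A)$, permuting tensor factors. $\bigotimes_{\mathbb{Z}^m}B$ is regarded as a unital, $\sigma$-invariant $C^*$-subalgebra of $\bigotimes_{\mathbb{Z}^m}A$. Rokhlin dimension of an action $\alpha$ of $\mathbb{Z}^m$ on a unital $C^*$-algebra $C$: for $n\in\mathbb{N}$ let $B_n=\{0,1,\dots,n-1\}^m\subseteq\mathbb{Z}^m$; $v+w \bmod n\mathbb{Z}^m$ denotes the representative in $B_n$. We write $\dim_{\mathrm{Rok}}(\alpha)\le d$ if for any finite subset $F\subseteq C$, $\varepsilon>0$ and $n\in\mathbb{N}$ there exist positive contractions $(f_v^{(\ell)})_{v\in B_n}^{\ell=0,\dots,d}$ in $C$ such that: (1) $\|\alpha^w(f_v^{(\ell)})-f^{(\ell)}_{(v+w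 \bmod n\mathbb{Z}^m)}\|<\varepsilon$ for $0\le\ell\le d$, $v\in B_n$, $w\in\mathbb{Z}^m$; (2) $\|f_v^{(\ell)}f_{v'}^{(\ell)}\|<\varepsilon$ for $0\le \ell\le d$ and $v\ne v'$ in $B_n$; (3) $\|[f_v^{(\ell)},a]\|<\varepsilon$ for all $\ell$, $v\in B_n$, $a\in F$; (4) $\|\sum_{\ell=0}^d\sum_{v\in B_n}f_v^{(\ell)}-1_C\|<\varepsilon$. $\dim_{\mathrm{Rok}}(\alpha)$ is the least such $d$, or $\infty$ if there is none. *)

theory Defs
  imports "HOL-Analysis.Analysis" "HOL-Library.Extended_Nat"
begin

section \<open>Unital C*-algebras\<close>

text \<open>
  The class is not based on \<^class>\<open>real_normed_algebra_1\<close>, so that the zero algebra is allowed.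
  In every other instance \<open>norm 1 = 1\<close> follows from the C*-identity.
\<close>

class unital_cstar_algebra = real_normed_algebra + banach + monoid_mult +
  fixes scaleC :: "complex \<Rightarrow> 'a \<Rightarrow> 'a"
    and star :: "'a \<Rightarrow> 'a"
  assumes scaleC_add_right: "scaleC c (x + y) = scaleC c x + scaleC c y"
    and scaleC_add_left: "scaleC (c + d) x = scaleC c x + scaleC d x"
    and scaleC_scaleC: "scaleC c (scaleC d x) = scaleC (c * d) x"
    and scaleR_eq_scaleC: "scaleR r x = scaleC (complex_of_real r) x"
    and norm_scaleC: "norm (scaleC c x) = cmod c * norm x"
    and mult_scaleC_left: "scaleC c x * y = scaleC c (x * y)"
    and mult_scaleC_right: "x * scaleC c y = scaleC c (x * y)"
    and star_star: "star (star x) = x"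
    and star_add: "star (x + y) = star x + star y"
    and star_scaleC: "star (scaleC c x) = scaleC (cnj c) (star x)"
    and star_mult: "star (x * y) = star y * star x"
    and cstar_identity: "norm (star x * x) = (norm x)\<^sup>2"

definition cstar_subalgebra :: "'a::unital_cstar_algebra set \<Rightarrow> bool" where
  "cstar_subalgebra S \<longleftrightarrow>
     closed S \<and> 0 \<in> S \<and> (\<forall>x\<in>S. \<forall>y\<in>S. x + y \<in> S \<and> x * y \<in> S) \<and>
     (\<forall>c. \<forall>x\<in>S. scaleC c x \<in> S) \<and> (\<forall>x\<in>S. star x \<in> S)"

definition star_automorphism :: "('a::unital_cstar_algebra \<Rightarrow> 'a) \<Rightarrow> bool" where
  "star_automorphism h \<longleftrightarrow>
     bij h \<and> (\<forall>x y. h (x + y) = h x + h y \<and> h (x * y) = h x * h y) \<and>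
     (\<forall>c x. h (scaleC c x) = scaleC c (h x)) \<and> (\<forall>x. h (star x) = star (h x))"

definition state :: "('a::unital_cstar_algebra \<Rightarrow> complex) \<Rightarrow> bool" where
  "state \<phi> \<longleftrightarrow>
     (\<forall>x y. \<phi> (x + y) = \<phi> x + \<phi> y) \<and> (\<forall>c x. \<phi> (scaleC c x) = c * \<phi> x) \<and>
     (\<forall>x. Im (\<phi> (star x * x)) = 0 \<and> 0 \<le> Re (\<phi> (star x * x))) \<and> \<phi> 1 = 1"

section \<open>Minimal tensor powers\<close>

text \<open>
  A function \<open>a\<close> that is \<open>1\<close> outside \<open>F\<close> stands for the elementary tensor \<open>\<Otimes>\<^sub>g a(g)\<close> in the tensor
  power over \<open>F\<close>. Regarding it as a function that is \<open>1\<close> outside a larger set \<open>F'\<close> amounts to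
  tensoring with units, so the connecting maps of the inductive system are built into this encoding.
\<close>

definition tensor_words :: "'g set \<Rightarrow> 'a set \<Rightarrow> ('g \<Rightarrow> 'a::monoid_mult) set" where
  "tensor_words F S = {a. (\<forall>g\<in>F. a g \<in> S) \<and> (\<forall>g. g \<notin> F \<longrightarrow> a g = 1)}"

text \<open>
  A list of functions stands for the sum of the corresponding elementary tensors over \<open>F\<close>;
  for nonempty \<open>F\<close> scalars can be absorbed into a factor, so these sums exhaust the algebraic
  tensor power. The product of two such sums is \<open>formal_mult\<close>.
\<close>

definition formal_mult :: "('g \<Rightarrow> 'a::times) list \<Rightarrow> ('g \<Rightarrow> 'a) list \<Rightarrow> ('g \<Rightarrow> 'a) list" where
  "formal_mult xs ys = concat (map (\<lambda>x. map (\<lambda>y g. x g * y g) ys) xs)"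

text \<open>
  Inner product in the Hilbert space tensor product, over \<open>g \<in> F\<close>, of the GNS spaces of the
  states \<open>\<phi> g\<close>: on the GNS space of \<open>\<phi>\<close> the inner product of the classes of \<open>x\<close> and \<open>y\<close> is
  \<open>\<phi> (x\<^sup>* y)\<close>.
\<close>

definition gns_inner ::
  "('g \<Rightarrow> 'a::unital_cstar_algebra \<Rightarrow> complex) \<Rightarrow> 'g set \<Rightarrow> ('g \<Rightarrow> 'a) list \<Rightarrow> ('g \<Rightarrow> 'a) list \<Rightarrow> complex"
  where
  "gns_inner \<phi> F xs ys =
     (\<Sum>x\<leftarrow>xs. \<Sum>y\<leftarrow>ys. \<Prod>g\<in>F. \<phi> g (star (x g) * y g))"

text \<open>
  The minimal (spatial) norm of the element \<open>xs\<close> of the algebraic tensor power over \<open>F\<close>: its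
  operator norm in the tensor product over \<open>F\<close> of copies of the universal representation. The
  latter is the direct sum of all GNS representations, so this is the supremum of the operator
  norms of \<open>xs\<close> in the tensor products of GNS representations, where \<open>xs\<close> acts by left
  multiplication; \<open>ys\<close> runs through the vectors of norm at most one in the dense subspace spanned
  by elementary tensors. (The explicit \<open>0\<close> only matters for the zero algebra, which has no states.)
\<close>

definition min_tensor_norm :: "'g set \<Rightarrow> ('g \<Rightarrow> 'a::unital_cstar_algebra) list \<Rightarrow> real" where
  "min_tensor_norm F xs =
     Sup (insert 0 {sqrt (Re (gns_inner \<phi> F (formal_mult xs ys) (formal_mult xs ys))) | \<phi> ys.
            (\<forall>g\<in>F. state (\<phi> g)) \<and> Re (gns_inner \<phi> F ys ys) \<le> 1})"

text \<open>
  For a map \<open>\<tau>\<close> giving elementary tensors as elements of a C*-algebra, \<open>finite_tensor \<tau> F S\<close> is the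
  closed span of the elementary tensors over \<open>F\<close> with factors in the subalgebra \<open>S\<close>, and
  \<open>infinite_tensor \<tau> S\<close> the closure of the union of these over all finite \<open>F\<close>.
\<close>

definition finite_tensor ::
  "(('g \<Rightarrow> 'a::unital_cstar_algebra) \<Rightarrow> 'c::unital_cstar_algebra) \<Rightarrow> 'g set \<Rightarrow> 'a set \<Rightarrow> 'c set"
  where
  "finite_tensor \<tau> F S = closure {\<Sum>a\<leftarrow>as. \<tau> a | as. set as \<subseteq> tensor_words F S}"

definition infinite_tensor ::
  "(('g \<Rightarrow> 'a::unital_cstar_algebra) \<Rightarrow> 'c::unital_cstar_algebra) \<Rightarrow> 'a set \<Rightarrow> 'c set"
  where
  "infinite_tensor \<tau> S = closure (\<Union>F\<in>{F. finite F \<and> F \<noteq> {}}. finite_tensor \<tau> F S)"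

text \<open>
  \<open>finite_tensor \<tau> F UNIV\<close>, with the elementary tensors \<open>\<tau> a\<close>, is a copy of the minimal tensor
  power of \<open>'a\<close> over \<open>F\<close>.
\<close>

definition is_min_tensor ::
  "(('g \<Rightarrow> 'a::unital_cstar_algebra) \<Rightarrow> 'c::unital_cstar_algebra) \<Rightarrow> 'g set \<Rightarrow> bool" where
  "is_min_tensor \<tau> F \<longleftrightarrow>
     (\<forall>a\<in>tensor_words F UNIV. \<forall>g\<in>F. \<forall>x y c.
        \<tau> (a(g := x + y)) = \<tau> (a(g := x)) + \<tau> (a(g := y)) \<and>
        \<tau> (a(g := scaleC c x)) = scaleC c (\<tau> (a(g := x)))) \<and>
     \<tau> (\<lambda>_. 1) = 1 \<and>
     (\<forall>a\<in>tensor_words F UNIV. \<forall>b\<in>tensor_words F UNIV. \<tau> (\<lambda>g. a g * b g) = \<tau> a * \<tau> b) \<and>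
     (\<forall>a\<in>tensor_words F UNIV. \<tau> (\<lambda>g. star (a g)) = star (\<tau> a)) \<and>
     (\<forall>as. set as \<subseteq> tensor_words F UNIV \<longrightarrow> norm (\<Sum>a\<leftarrow>as. \<tau> a) = min_tensor_norm F as)"

text \<open>
  The C*-algebra \<open>'c\<close>, with the elementary tensors \<open>\<tau> a\<close>, is the inductive limit of the minimal
  tensor powers of \<open>'a\<close> over the finite subsets of \<open>'g\<close>. This determines the pair of \<open>'c\<close> and \<open>\<tau>\<close>
  (on functions that are \<open>1\<close> off a finite set) up to a unique isomorphism.
\<close>

definition is_infinite_tensor ::
  "(('g \<Rightarrow> 'a::unital_cstar_algebra) \<Rightarrow> 'c::unital_cstar_algebra) \<Rightarrow> bool" where
  "is_infinite_tensor \<tau> \<longleftrightarrow>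
     (\<forall>F. finite F \<and> F \<noteq> {} \<longrightarrow> is_min_tensor \<tau> F) \<and> infinite_tensor \<tau> UNIV = UNIV"

definition is_bernoulli_action ::
  "(('g::group_add \<Rightarrow> 'a::unital_cstar_algebra) \<Rightarrow> 'c::unital_cstar_algebra) \<Rightarrow> ('g \<Rightarrow> 'c \<Rightarrow> 'c) \<Rightarrow> bool"
  where
  "is_bernoulli_action \<tau> \<sigma> \<longleftrightarrow>
     (\<forall>g. star_automorphism (\<sigma> g)) \<and> \<sigma> 0 = id \<and> (\<forall>g h. \<sigma> (g + h) = \<sigma> g \<circ> \<sigma> h) \<and>
     (\<forall>F. finite F \<longrightarrow> (\<forall>a\<in>tensor_words F UNIV. \<forall>g. \<sigma> g (\<tau> a) = \<tau> (\<lambda>h. a (- g + h))))"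

section \<open>Rokhlin dimension\<close>

definition positive_contraction :: "'c::unital_cstar_algebra set \<Rightarrow> 'c \<Rightarrow> bool" where
  "positive_contraction D x \<longleftrightarrow> (\<exists>y\<in>D. x = star y * y) \<and> norm x \<le> 1"

definition rok_box :: "nat \<Rightarrow> (int ^ 'm) set" where
  "rok_box n = {v. \<forall>i. 0 \<le> v $ i \<and> v $ i < int n}"

definition rok_mod :: "nat \<Rightarrow> int ^ 'm \<Rightarrow> int ^ 'm" where
  "rok_mod n v = (\<chi> i. v $ i mod int n)"

text \<open>
  \<open>D\<close> is the unital C*-subalgebra on which \<open>\<alpha>\<close> acts. Here \<open>n \<ge> 1\<close>: the box for \<open>n = 0\<close> is empty,
  and the last condition could never hold.
\<close>

definition rokhlin_dim_le ::
  "'c::unital_cstar_algebra set \<Rightarrow> (int ^ 'm::finite \<Rightarrow> 'c \<Rightarrow> 'c) \<Rightarrow> nat \<Rightarrow> bool" where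
  "rokhlin_dim_le D \<alpha> d \<longleftrightarrow>
     (\<forall>F \<epsilon> n. finite F \<and> F \<subseteq> D \<and> 0 < \<epsilon> \<and> 1 \<le> n \<longrightarrow>
       (\<exists>f :: nat \<Rightarrow> int ^ 'm \<Rightarrow> 'c.
          (\<forall>l\<le>d. \<forall>v\<in>rok_box n. positive_contraction D (f l v)) \<and>
          (\<forall>l\<le>d. \<forall>v\<in>rok_box n. \<forall>w. norm (\<alpha> w (f l v) - f l (rok_mod n (v + w))) < \<epsilon>) \<and>
          (\<forall>l\<le>d. \<forall>v\<in>rok_box n. \<forall>v'\<in>rok_box n. v \<noteq> v' \<longrightarrow> norm (f l v * f l v') < \<epsilon>) \<and>
          (\<forall>l\<le>d. \<forall>v\<in>rok_box n. \<forall>a\<in>F. norm (f l v * a - a * f l v) < \<epsilon>) \<and>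
          norm ((\<Sum>l\<le>d. \<Sum>v\<in>rok_box n. f l v) - 1) < \<epsilon>))"

definition rokhlin_dim ::
  "'c::unital_cstar_algebra set \<Rightarrow> (int ^ 'm::finite \<Rightarrow> 'c \<Rightarrow> 'c) \<Rightarrow> enat" where
  "rokhlin_dim D \<alpha> = Inf {enat d | d. rokhlin_dim_le D \<alpha> d}"

end

theory Submission
  imports Defs
begin

text \<open>
  Translating Rokhlin towers far away makes them almost central. Because \<open>\<int>\<^sup>m\<close> is abelian, each
  \<open>\<sigma>\<^sup>w\<close> is an automorphism that commutes with the whole action, so if \<open>f\<close> is a family of Rokhlin
  towers, then \<open>\<sigma>\<^sup>w f\<close> satisfies the equivariance, orthogonality and partition-of-unity conditions
  with the same \<open>\<epsilon>\<close>. The only condition that refers to the larger algebra is the commutation with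
  a given finite set, and it comes for free from \<open>w\<close>: up to small errors, \<open>f\<close> and the given
  elements lie in finite tensor powers, and the supports are disjoint after translation by all but
  finitely many \<open>w\<close>; tensors with disjoint supports commute
  (\<open>bernoulli_asymptotically_commutes\<close>). Thus towers in the small tensor power, taken for the
  empty finite set, translate to towers for any finite subset of the large one.

  Both the transport of norm estimates along \<open>\<sigma>\<^sup>w\<close> and the approximation by finite tensors rest on
  the fact that unital \<open>*\<close>-homomorphisms of C*-algebras are contractive
  (\<open>unital_star_hom_contractive\<close>). It is proved without spectral theory: a self-adjoint \<open>a\<close> with
  \<open>\<parallel>a\<parallel> < 1\<close> satisfies \<open>a\<^sup>2 + c\<^sup>2 = 1\<close> for some self-adjoint \<open>c\<close> commuting with it, an algebraic
  relation which every unital \<open>*\<close>-homomorphism preserves, and which says that \<open>a + ic\<close> is unitary,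
  so that \<open>a\<close>, its real part, is a contraction.
\<close>

section \<open>Contractivity of unital *-homomorphisms\<close>

lemma scaleC_zero: "scaleC 0 x = (0 :: 'a::unital_cstar_algebra)"
  using scaleR_eq_scaleC[of 0 x] by simp

lemma scaleC_one: "scaleC 1 x = (x :: 'a::unital_cstar_algebra)"
  using scaleR_eq_scaleC[of 1 x] by simp

lemma star_scaleR: "star (r *\<^sub>R x) = r *\<^sub>R star (x :: 'a::unital_cstar_algebra)"
  by (simp add: scaleR_eq_scaleC star_scaleC)

lemma star_minus: "star (- x) = - star (x :: 'a::unital_cstar_algebra)"
  using star_scaleR[of "-1" x] by simp

lemma star_diff: "star (x - y) = star x - star (y :: 'a::unital_cstar_algebra)"
  using star_add[of x "- y"] by (simp add: star_minus)

lemma star_zero: "star 0 = (0 :: 'a::unital_cstar_algebra)"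
  using star_scaleR[of 0 0] by simp

lemma star_one: "star 1 = (1 :: 'a::unital_cstar_algebra)"
  by (metis star_mult star_star mult_1_right)

lemma norm_star_le: "norm x \<le> norm (star (x :: 'a::unital_cstar_algebra))"
proof (cases "norm x = 0")
  case False
  have "norm x * norm x \<le> norm (star x) * norm x"
    using cstar_identity[of x] norm_mult_ineq[of "star x" x] by (simp add: power2_eq_square)
  then show ?thesis using False by simp
qed simp

lemma norm_star: "norm (star x) = norm (x :: 'a::unital_cstar_algebra)"
  using norm_star_le[of x] norm_star_le[of "star x"] by (simp add: star_star)

lemma norm_one_le: "norm (1 :: 'a::unital_cstar_algebra) \<le> 1"
  using cstar_identity[of "1 :: 'a"] by (auto simp: star_one power2_eq_square)

lemma continuous_on_star:
  "continuous_on S (star :: 'a::unital_cstar_algebra \<Rightarrow> 'a)"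
proof -
  have "bounded_linear (star :: 'a \<Rightarrow> 'a)"
    by (rule bounded_linear_intro[where K = 1]) (simp_all add: star_add star_scaleR norm_star)
  then show ?thesis by (rule linear_continuous_on)
qed

text \<open>
  The element \<open>u = b + ic\<close> is unitary, hence of norm at most one, and \<open>b\<close> is the mean of \<open>u\<close> and
  \<open>u\<^sup>*\<close>.
\<close>

lemma norm_le_one_of_square_sum_one:
  fixes b c :: "'a::unital_cstar_algebra"
  assumes b: "star b = b" and c: "star c = c" and comm: "b * c = c * b"
    and sum: "b * b + c * c = 1"
  shows "norm b \<le> 1"
proof -
  define u where "u = b + scaleC \<i> c"
  have su: "star u = b + scaleC (- \<i>) c"
    by (simp add: u_def star_add star_scaleC b c)
  have cancel: "scaleC \<i> x + scaleC (- \<i>) x = 0" for x :: 'a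
    using scaleC_add_left[of \<i> "- \<i>" x] by (simp add: scaleC_zero)
  have "star u * u = b * b + (scaleC \<i> (c * b) + scaleC (- \<i>) (c * b)) + c * c"
    by (simp add: su) (simp add: u_def distrib_left distrib_right mult_scaleC_left
        mult_scaleC_right scaleC_scaleC scaleC_one scaleC_add_right comm add.assoc)
  then have "star u * u = 1" by (simp add: cancel sum)
  then have "(norm u)\<^sup>2 \<le> 1" using cstar_identity[of u] norm_one_le[where 'a='a] by simp
  then have u1: "norm u \<le> 1" by (simp add: power2_le_iff_abs_le abs_square_le_1)
  have "u + star u = b + b + (scaleC \<i> c + scaleC (- \<i>) c)"
    by (simp add: su) (simp add: u_def)
  then have "2 *\<^sub>R b = u + star u" by (simp add: cancel scaleR_2)
  then have "2 * norm b = norm (u + star u)" by (metis norm_scaleR abs_numeral)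
  also have "\<dots> \<le> norm u + norm (star u)" by (rule norm_triangle_ineq)
  finally show ?thesis using u1 by (simp add: norm_star)
qed

text \<open>
  The element \<open>c = \<surd>(1 - a\<^sup>2)\<close> is \<open>1 - x\<close> for a solution \<open>x\<close> of \<open>x = (a\<^sup>2 + x\<^sup>2)/2\<close>. With
  \<open>r = \<parallel>a\<^sup>2\<parallel> < 1\<close>, the right-hand side maps the ball of radius \<open>r\<close> to itself, since
  \<open>(r + r\<^sup>2)/2 \<le> r\<close>, and it is a contraction there with constant \<open>r\<close>.
\<close>

lemma selfadjoint_complementary_square:
  fixes a :: "'a::unital_cstar_algebra"
  assumes a: "star a = a" and "norm a < 1"
  obtains c where "star c = c" "a * c = c * a" "a * a + c * c = 1"
proof -
  define r where "r = norm (a * a)"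
  have "r = (norm a)\<^sup>2" unfolding r_def using cstar_identity[of a] a by simp
  then have r0: "0 \<le> r" and r1: "r < 1"
    using \<open>norm a < 1\<close> by (simp_all add: abs_square_less_1)
  define S where "S = {x. star x = x} \<inter> {x. a * x = x * a} \<inter> cball 0 r"
  define \<Phi> where "\<Phi> x = (1/2) *\<^sub>R (a * a + x * x)" for x
  have "closed S"
    unfolding S_def
    by (intro closed_Int closed_Collect_eq closed_cball continuous_on_star continuous_intros)
  then have "complete S" by (simp add: complete_eq_closed)
  moreover have "0 \<in> S" using r0 by (simp add: S_def star_zero)
  then have "S \<noteq> {}" by blast
  moreover have "\<Phi> ` S \<subseteq> S"
  proof
    fix y assume "y \<in> \<Phi> ` S"
    then obtain x where y: "y = \<Phi> x" and x: "star x = x" "a * x = x * a" "norm x \<le> r"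
      by (auto simp: S_def)
    have "norm (x * x) \<le> r * r"
      using norm_mult_ineq[of x x] mult_mono[OF x(3) x(3) r0] by simp
    also have "\<dots> \<le> r" using mult_left_mono[of r 1 r] r0 r1 by simp
    finally have "norm (a * a + x * x) \<le> 2 * r"
      using norm_triangle_ineq[of "a * a" "x * x"] by (simp add: r_def)
    then have "norm y \<le> r" by (simp add: y \<Phi>_def)
    moreover have "star y = y" by (simp add: y \<Phi>_def star_scaleR star_add star_mult a x)
    moreover have "a * (x * x) = x * x * a" by (metis x(2) mult.assoc)
    then have "a * y = y * a" by (simp add: y \<Phi>_def distrib_left distrib_right mult.assoc)
    ultimately show "y \<in> S" by (simp add: S_def)
  qed
  moreover have "dist (\<Phi> x) (\<Phi> y) \<le> r * dist x y" if "x \<in> S" "y \<in> S" for x y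
  proof -
    have n: "norm x \<le> r" "norm y \<le> r" using that by (auto simp: S_def)
    have "\<Phi> x - \<Phi> y = (1/2) *\<^sub>R (x * (x - y) + (x - y) * y)"
      by (simp add: \<Phi>_def algebra_simps)
    then have "dist (\<Phi> x) (\<Phi> y) = norm (x * (x - y) + (x - y) * y) / 2"
      by (simp add: dist_norm)
    also have "\<dots> \<le> (norm x * norm (x - y) + norm (x - y) * norm y) / 2"
      by (intro divide_right_mono order_trans[OF norm_triangle_ineq] add_mono norm_mult_ineq) simp
    also have "\<dots> \<le> (r * norm (x - y) + norm (x - y) * r) / 2"
      by (intro divide_right_mono add_mono mult_right_mono mult_left_mono n) simp_all
    finally show ?thesis by (simp add: dist_norm)
  qed
  ultimately have "\<exists>!x\<in>S. \<Phi> x = x"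
    by (intro Banach_fix[OF _ _ r0 r1]) auto
  then obtain x where x: "star x = x" "a * x = x * a" and fp: "\<Phi> x = x"
    by (auto simp: S_def)
  have "2 *\<^sub>R \<Phi> x = a * a + x * x" by (simp add: \<Phi>_def)
  then have "a * a + x * x = 2 *\<^sub>R x" by (simp add: fp)
  then have "a * a + (1 - x) * (1 - x) = 1" by (simp add: algebra_simps scaleR_2)
  moreover have "star (1 - x) = 1 - x" by (simp add: star_diff star_one x)
  moreover have "a * (1 - x) = (1 - x) * a" by (simp add: algebra_simps x)
  ultimately show ?thesis using that by blast
qed

text \<open>
  The image of a self-adjoint \<open>a\<close> with \<open>\<parallel>a\<parallel> < 1\<close> is again the real part of a unitary. Scaling gives
  the estimate for all self-adjoint elements, and the C*-identity reduces the general case to them.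
\<close>

lemma unital_star_hom_contractive:
  fixes h :: "'a::unital_cstar_algebra \<Rightarrow> 'b::unital_cstar_algebra"
  assumes add: "\<And>x y. h (x + y) = h x + h y" and mult: "\<And>x y. h (x * y) = h x * h y"
    and scale: "\<And>c x. h (scaleC c x) = scaleC c (h x)"
    and star: "\<And>x. h (star x) = star (h x)" and one: "h 1 = 1"
  shows "norm (h x) \<le> norm x"
proof -
  have le1: "norm (h a) \<le> 1" if sa: "star a = a" and a1: "norm a < 1" for a
  proof -
    obtain c where c: "star c = c" "a * c = c * a" "a * a + c * c = 1"
      using selfadjoint_complementary_square[OF sa a1] .
    show ?thesis
    proof (rule norm_le_one_of_square_sum_one)
      show "star (h a) = h a" by (metis sa star)
      show "star (h c) = h c" by (metis c(1) star)
      show "h a * h c = h c * h a" by (metis c(2) mult)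
      show "h a * h a + h c * h c = 1" by (metis c(3) add mult one)
    qed
  qed
  have sa_le: "norm (h a) \<le> norm a" if sa: "star a = a" for a
  proof (rule dense_ge)
    fix t assume t: "norm a < t"
    then have t0: "0 < t" using norm_ge_zero[of a] by linarith
    have "norm (h ((1/t) *\<^sub>R a)) \<le> 1"
      using t t0 by (intro le1) (simp_all add: star_scaleR sa)
    then show "norm (h a) \<le> t"
      using t0 by (simp add: scaleR_eq_scaleC scale norm_scaleC norm_divide field_simps)
  qed
  have "(norm (h x))\<^sup>2 = norm (h (star x * x))" by (simp add: mult star cstar_identity)
  also have "\<dots> \<le> norm (star x * x)" by (intro sa_le) (simp add: star_mult star_star)
  also have "\<dots> = (norm x)\<^sup>2" by (rule cstar_identity)
  finally show ?thesis by (rule power2_le_imp_le) simp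
qed

lemma star_automorphism_one:
  assumes "star_automorphism h" shows "h 1 = 1"
proof -
  have "surj h" and mult: "h (x * y) = h x * h y" for x y
    using assms by (auto simp: star_automorphism_def bij_def)
  then obtain e where "h e = 1" by (metis surjD)
  then show ?thesis using mult[of e 1] by simp
qed

lemma star_automorphism_norm_le:
  assumes "star_automorphism h" shows "norm (h x) \<le> norm x"
  using assms star_automorphism_one[OF assms]
  by (intro unital_star_hom_contractive) (auto simp: star_automorphism_def)

lemma star_automorphism_additive:
  "star_automorphism h \<Longrightarrow> Modules.additive h"
  by (simp add: star_automorphism_def Modules.additive_def)

lemma positive_contraction_star_automorphism:
  assumes h: "star_automorphism h" and "positive_contraction D x"
  shows "positive_contraction UNIV (h x)"
proof -
  obtain y where y: "x = star y * y" and "norm x \<le> 1"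
    using assms(2) by (auto simp: positive_contraction_def)
  then have "norm (h x) \<le> 1" using star_automorphism_norm_le[OF h, of x] by simp
  moreover have "h x = star (h y) * h y" using h by (simp add: y star_automorphism_def)
  ultimately show ?thesis by (auto simp: positive_contraction_def)
qed

section \<open>Asymptotic commutation under the Bernoulli action\<close>

lemma infinite_tensor_approx:
  assumes "x \<in> infinite_tensor \<tau> S" and "0 < \<epsilon>"
  obtains F as where "finite F" "set as \<subseteq> tensor_words F S" "norm (x - (\<Sum>a\<leftarrow>as. \<tau> a)) < \<epsilon>"
proof -
  have half: "0 < \<epsilon> / 2" using assms(2) by simp
  obtain y where y: "y \<in> (\<Union>F\<in>{F. finite F \<and> F \<noteq> {}}. finite_tensor \<tau> F S)" "dist y x < \<epsilon> / 2"
    using closure_approachableD[OF assms(1)[unfolded infinite_tensor_def] half]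
    by (auto simp: dist_commute)
  then obtain F where F: "finite F" "y \<in> finite_tensor \<tau> F S" by blast
  obtain z where "z \<in> {\<Sum>a\<leftarrow>as. \<tau> a | as. set as \<subseteq> tensor_words F S}" "dist z y < \<epsilon> / 2"
    using closure_approachableD[OF F(2)[unfolded finite_tensor_def] half]
    by (auto simp: dist_commute)
  then obtain as where as: "set as \<subseteq> tensor_words F S" "dist (\<Sum>a\<leftarrow>as. \<tau> a) y < \<epsilon> / 2"
    by blast
  have "dist (\<Sum>a\<leftarrow>as. \<tau> a) x < \<epsilon>"
    using dist_triangle[of "\<Sum>a\<leftarrow>as. \<tau> a" x y] y(2) as(2) by simp
  then show ?thesis using that[OF F(1) as(1)] by (simp add: dist_norm norm_minus_commute)
qed

text \<open>
  Over the common index set \<open>F \<union> G\<close> both products are computed factor by factor, and in every factor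
  at least one of the two entries is \<open>1\<close>.
\<close>

lemma disjoint_tensors_commute:
  assumes "is_infinite_tensor \<tau>" "finite F" "finite G" "F \<inter> G = {}"
    and a: "a \<in> tensor_words F UNIV" and b: "b \<in> tensor_words G UNIV"
  shows "\<tau> a * \<tau> b = \<tau> b * \<tau> a"
proof (cases "F \<union> G = {}")
  case True
  then have "a = b" using a b by (auto simp: tensor_words_def)
  then show ?thesis by simp
next
  case False
  then have "is_min_tensor \<tau> (F \<union> G)" using assms by (auto simp: is_infinite_tensor_def)
  moreover have "a \<in> tensor_words (F \<union> G) UNIV" "b \<in> tensor_words (F \<union> G) UNIV"
    using a b by (auto simp: tensor_words_def)
  ultimately have "\<tau> (\<lambda>g. a g * b g) = \<tau> a * \<tau> b" "\<tau> (\<lambda>g. b g * a g) = \<tau> b * \<tau> a"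
    unfolding is_min_tensor_def by blast+
  moreover have "a g * b g = b g * a g" for g
    using a b assms(4) by (cases "g \<in> F") (auto simp: tensor_words_def)
  ultimately show ?thesis by simp
qed

lemma commute_sum_list:
  fixes x :: "'a::semiring_0"
  assumes "\<And>b. b \<in> set bs \<Longrightarrow> x * g b = g b * x"
  shows "x * (\<Sum>b\<leftarrow>bs. g b) = (\<Sum>b\<leftarrow>bs. g b) * x"
  using assms by (induction bs) (auto simp: distrib_left distrib_right)

text \<open>
  For finite sums of elementary tensors, supported on \<open>F\<close> and \<open>G\<close>, the commutator vanishes exactly
  once \<open>w + F\<close> misses \<open>G\<close>, which only fails for the finitely many differences \<open>w = g - f\<close>.
\<close>

lemma bernoulli_eventually_commutes:
  fixes \<tau> :: "('g::group_add \<Rightarrow> 'a::unital_cstar_algebra) \<Rightarrow> 'c::unital_cstar_algebra"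
  assumes \<tau>: "is_infinite_tensor \<tau>" and \<sigma>: "is_bernoulli_action \<tau> \<sigma>"
    and fin: "finite F" "finite G"
    and as: "set as \<subseteq> tensor_words F UNIV" and bs: "set bs \<subseteq> tensor_words G UNIV"
  shows "\<forall>\<^sub>F w in cofinite.
    \<sigma> w (\<Sum>a\<leftarrow>as. \<tau> a) * (\<Sum>b\<leftarrow>bs. \<tau> b) = (\<Sum>b\<leftarrow>bs. \<tau> b) * \<sigma> w (\<Sum>a\<leftarrow>as. \<tau> a)"
proof -
  let ?K = "(\<lambda>(g, f). g - f) ` (G \<times> F)"
  have "\<sigma> w (\<Sum>a\<leftarrow>as. \<tau> a) * (\<Sum>b\<leftarrow>bs. \<tau> b) = (\<Sum>b\<leftarrow>bs. \<tau> b) * \<sigma> w (\<Sum>a\<leftarrow>as. \<tau> a)"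
    if w: "w \<notin> ?K" for w
  proof -
    have add: "Modules.additive (\<sigma> w)"
      using \<sigma> by (simp add: is_bernoulli_action_def star_automorphism_additive)
    have shift: "\<sigma> w (\<Sum>a\<leftarrow>as'. \<tau> a) = (\<Sum>a\<leftarrow>as'. \<sigma> w (\<tau> a))" for as'
      by (induction as') (simp_all add: additive.add[OF add] additive.zero[OF add])
    have disj: "(\<lambda>f. w + f) ` F \<inter> G = {}"
    proof -
      have "w + f \<notin> G" if "f \<in> F" for f
      proof
        assume "w + f \<in> G"
        then have "(w + f) - f \<in> ?K" using that by force
        then show False using w by simp
      qed
      then show ?thesis by auto
    qed
    have "\<sigma> w (\<tau> a) * \<tau> b = \<tau> b * \<sigma> w (\<tau> a)" if "a \<in> set as" "b \<in> set bs" for a b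
    proof -
      have a: "a \<in> tensor_words F UNIV" and b: "b \<in> tensor_words G UNIV"
        using that as bs by auto
      have "\<sigma> w (\<tau> a) = \<tau> (\<lambda>h. a (- w + h))"
        using \<sigma> fin(1) a by (auto simp: is_bernoulli_action_def)
      moreover have "(\<lambda>h. a (- w + h)) \<in> tensor_words ((\<lambda>f. w + f) ` F) UNIV"
      proof -
        have "a (- w + h) = 1" if "h \<notin> (\<lambda>f. w + f) ` F" for h
        proof -
          have "- w + h \<notin> F" using that by (metis add_minus_cancel imageI)
          then show ?thesis using a by (simp add: tensor_words_def)
        qed
        then show ?thesis by (simp add: tensor_words_def)
      qed
      ultimately show ?thesis
        using disjoint_tensors_commute[OF \<tau> _ fin(2) disj _ b] fin(1) by simp
    qed
    then have "\<sigma> w (\<tau> a) * (\<Sum>b\<leftarrow>bs. \<tau> b) = (\<Sum>b\<leftarrow>bs. \<tau> b) * \<sigma> w (\<tau> a)"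
      if "a \<in> set as" for a
      using that by (intro commute_sum_list) auto
    then show ?thesis
      using commute_sum_list[of as "\<Sum>b\<leftarrow>bs. \<tau> b" "\<lambda>a. \<sigma> w (\<tau> a)"] by (simp add: shift)
  qed
  then have "{w. \<not> \<sigma> w (\<Sum>a\<leftarrow>as. \<tau> a) * (\<Sum>b\<leftarrow>bs. \<tau> b)
      = (\<Sum>b\<leftarrow>bs. \<tau> b) * \<sigma> w (\<Sum>a\<leftarrow>as. \<tau> a)} \<subseteq> ?K" by blast
  then show ?thesis
    unfolding eventually_cofinite by (rule finite_subset) (use fin in simp)
qed

lemma norm_commutator_le:
  fixes x y :: "'a::real_normed_algebra"
  shows "norm (x * y - y * x) \<le> 2 * (norm x * norm y)"
  using norm_triangle_ineq4[of "x * y" "y * x"] norm_mult_ineq[of x y] norm_mult_ineq[of y x]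
  by (simp add: mult.commute)

lemma exists_pos_mult_less:
  fixes K \<epsilon> :: real
  assumes "0 \<le> K" "0 < \<epsilon>"
  obtains \<delta> where "0 < \<delta>" "\<And>t. t < \<delta> \<Longrightarrow> K * t < \<epsilon>"
proof
  show "0 < \<epsilon> / (K + 1)" using assms by simp
  fix t assume "t < \<epsilon> / (K + 1)"
  then have *: "(K + 1) * t < \<epsilon>" using assms by (simp add: field_simps)
  show "K * t < \<epsilon>"
  proof (cases "0 \<le> t")
    case True then show ?thesis using * by (simp add: distrib_right)
  next
    case False then show ?thesis using assms mult_nonneg_nonpos[of K t] by linarith
  qed
qed

text \<open>
  Contractivity of \<open>\<sigma> w\<close> makes the approximation of \<open>x\<close> by a finite sum uniform in \<open>w\<close>.
\<close>

lemma bernoulli_asymptotically_commutes: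
  fixes \<tau> :: "('g::group_add \<Rightarrow> 'a::unital_cstar_algebra) \<Rightarrow> 'c::unital_cstar_algebra"
  assumes \<tau>: "is_infinite_tensor \<tau>" and \<sigma>: "is_bernoulli_action \<tau> \<sigma>" and "0 < \<epsilon>"
  shows "\<forall>\<^sub>F w in cofinite. norm (\<sigma> w x * y - y * \<sigma> w x) < \<epsilon>"
proof -
  have dense: "z \<in> infinite_tensor \<tau> UNIV" for z
    using \<tau> by (simp add: is_infinite_tensor_def)
  obtain \<delta> where \<delta>: "0 < \<delta>" "\<And>t. t < \<delta> \<Longrightarrow> (2 * norm y) * t < \<epsilon> / 2"
    using exists_pos_mult_less[of "2 * norm y" "\<epsilon> / 2"] \<open>0 < \<epsilon>\<close> by auto
  obtain F as where as: "finite F" "set as \<subseteq> tensor_words F UNIV"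
      "norm (x - (\<Sum>a\<leftarrow>as. \<tau> a)) < \<delta>"
    using infinite_tensor_approx[OF dense \<delta>(1)] .
  define x' where "x' = (\<Sum>a\<leftarrow>as. \<tau> a)"
  obtain \<eta> where \<eta>: "0 < \<eta>" "\<And>t. t < \<eta> \<Longrightarrow> (2 * norm x') * t < \<epsilon> / 2"
    using exists_pos_mult_less[of "2 * norm x'" "\<epsilon> / 2"] \<open>0 < \<epsilon>\<close> by auto
  obtain G bs where bs: "finite G" "set bs \<subseteq> tensor_words G UNIV"
      "norm (y - (\<Sum>b\<leftarrow>bs. \<tau> b)) < \<eta>"
    using infinite_tensor_approx[OF dense \<eta>(1)] .
  define y' where "y' = (\<Sum>b\<leftarrow>bs. \<tau> b)"
  have "\<forall>\<^sub>F w in cofinite. \<sigma> w x' * y' = y' * \<sigma> w x'"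
    unfolding x'_def y'_def by (rule bernoulli_eventually_commutes[OF \<tau> \<sigma> as(1) bs(1) as(2) bs(2)])
  then show ?thesis
  proof (rule eventually_mono)
    fix w assume comm: "\<sigma> w x' * y' = y' * \<sigma> w x'"
    have aut: "star_automorphism (\<sigma> w)" using \<sigma> by (simp add: is_bernoulli_action_def)
    let ?p = "\<sigma> w (x - x')" and ?q = "y - y'"
    have "\<sigma> w x = ?p + \<sigma> w x'"
      by (simp add: additive.diff[OF star_automorphism_additive[OF aut]])
    then have "\<sigma> w x * y - y * \<sigma> w x = (?p * y - y * ?p) + (\<sigma> w x' * ?q - ?q * \<sigma> w x')"
      using comm by (simp add: algebra_simps)
    then have "norm (\<sigma> w x * y - y * \<sigma> w x) \<le>
        norm (?p * y - y * ?p) + norm (\<sigma> w x' * ?q - ?q * \<sigma> w x')"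
      using norm_triangle_ineq by metis
    also have "\<dots> \<le> 2 * (norm ?p * norm y) + 2 * (norm (\<sigma> w x') * norm ?q)"
      by (intro add_mono norm_commutator_le)
    also have "\<dots> \<le> 2 * (norm (x - x') * norm y) + 2 * (norm x' * norm ?q)"
      by (intro add_mono mult_left_mono mult_right_mono star_automorphism_norm_le[OF aut]) simp_all
    also have "\<dots> < \<epsilon>"
      using \<delta>(2)[of "norm (x - x')"] \<eta>(2)[of "norm ?q"] as(3) bs(3)
      by (simp add: x'_def y'_def mult_ac)
    finally show "norm (\<sigma> w x * y - y * \<sigma> w x) < \<epsilon>" .
  qed
qed

section \<open>Translating Rokhlin towers\<close>

lemma infinite_UNIV_int_vec: "infinite (UNIV :: (int ^ 'm::finite) set)"
proof -
  have "inj (\<lambda>k. (\<chi> i. k) :: int ^ 'm)" by (rule injI) (metis vec_lambda_beta)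
  then have "infinite (range (\<lambda>k. (\<chi> i. k) :: int ^ 'm))"
    by (simp add: finite_image_iff infinite_UNIV_int)
  then show ?thesis by (rule infinite_super[OF subset_UNIV])
qed

lemma finite_rok_box: "finite (rok_box n :: (int ^ 'm::finite) set)"
proof (rule finite_subset)
  show "(rok_box n :: (int ^ 'm) set) \<subseteq> vec_lambda ` (\<Pi>\<^sub>E i\<in>UNIV. {0..<int n})"
  proof
    fix v :: "int ^ 'm" assume "v \<in> rok_box n"
    then have "(\<lambda>i. v $ i) \<in> (\<Pi>\<^sub>E i\<in>UNIV. {0..<int n})" by (auto simp: rok_box_def)
    then show "v \<in> vec_lambda ` (\<Pi>\<^sub>E i\<in>UNIV. {0..<int n})"
      by (metis image_eqI vec_lambda_eta)
  qed
qed (simp add: finite_PiE)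

lemma rokhlin_dim_le_UNIV:
  fixes \<tau> :: "(int ^ 'm::finite \<Rightarrow> 'a::unital_cstar_algebra) \<Rightarrow> 'c::unital_cstar_algebra"
  assumes \<tau>: "is_infinite_tensor \<tau>" and \<sigma>: "is_bernoulli_action \<tau> \<sigma>"
    and D: "rokhlin_dim_le D \<sigma> d"
  shows "rokhlin_dim_le UNIV \<sigma> d"
  unfolding rokhlin_dim_le_def
proof (intro allI impI, elim conjE)
  fix F :: "'c set" and \<epsilon> :: real and n :: nat
  assume F: "finite F" and \<epsilon>: "0 < \<epsilon>" and n: "1 \<le> n"
  \<comment> \<open>The elements of \<open>F\<close> need not lie in \<open>D\<close>; translation, not the choice of the towers, will make
    the towers commute with them.\<close>
  have "finite ({} :: 'c set) \<and> {} \<subseteq> D \<and> 0 < \<epsilon> \<and> 1 \<le> n" using \<epsilon> n by simp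
  note towers = D[unfolded rokhlin_dim_le_def, THEN spec, THEN spec, THEN spec, THEN mp, OF this]
  obtain f where
    f: "(\<forall>l\<le>d. \<forall>v\<in>rok_box n. positive_contraction D (f l v)) \<and>
      (\<forall>l\<le>d. \<forall>v\<in>rok_box n. \<forall>u. norm (\<sigma> u (f l v) - f l (rok_mod n (v + u))) < \<epsilon>) \<and>
      (\<forall>l\<le>d. \<forall>v\<in>rok_box n. \<forall>v'\<in>rok_box n. v \<noteq> v' \<longrightarrow> norm (f l v * f l v') < \<epsilon>) \<and>
      (\<forall>l\<le>d. \<forall>v\<in>rok_box n. \<forall>a\<in>{}. norm (f l v * a - a * f l v) < \<epsilon>) \<and>
      norm ((\<Sum>l\<le>d. \<Sum>v\<in>rok_box n. f l v) - 1) < \<epsilon>"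
    using towers by (rule exE)
  note pos = f[THEN conjunct1]
    and equi = f[THEN conjunct2, THEN conjunct1]
    and orth = f[THEN conjunct2, THEN conjunct2, THEN conjunct1]
    and unit = f[THEN conjunct2, THEN conjunct2, THEN conjunct2, THEN conjunct2]
  have "\<forall>\<^sub>F w in cofinite. \<forall>l\<in>{..d}. \<forall>v\<in>rok_box n. \<forall>a\<in>F.
      norm (\<sigma> w (f l v) * a - a * \<sigma> w (f l v)) < \<epsilon>"
    by (intro eventually_ball_finite ballI finite_rok_box F finite_atMost
        bernoulli_asymptotically_commutes[OF \<tau> \<sigma> \<epsilon>])
  moreover have "(cofinite :: (int ^ 'm) filter) \<noteq> bot"
    by (simp add: cofinite_bot infinite_UNIV_int_vec)
  ultimately obtain w where
    w: "\<forall>l\<in>{..d}. \<forall>v\<in>rok_box n. \<forall>a\<in>F. norm (\<sigma> w (f l v) * a - a * \<sigma> w (f l v)) < \<epsilon>"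
    using eventually_happens' by blast
  have aut: "star_automorphism (\<sigma> w)" using \<sigma> by (simp add: is_bernoulli_action_def)
  note add = star_automorphism_additive[OF aut]
  have less: "norm (\<sigma> w x) < \<epsilon>" if "norm x < \<epsilon>" for x
    using star_automorphism_norm_le[OF aut, of x] that by simp
  have comm: "\<sigma> u (\<sigma> w x) = \<sigma> w (\<sigma> u x)" for u x
  proof -
    have comp: "\<sigma> (g + h) = \<sigma> g \<circ> \<sigma> h" for g h
      using \<sigma> by (simp add: is_bernoulli_action_def)
    show ?thesis using comp[of u w] comp[of w u] by (metis add.commute comp_apply)
  qed
  have mult: "\<sigma> w (x * y) = \<sigma> w x * \<sigma> w y" for x y
    using aut by (simp add: star_automorphism_def)
  show "\<exists>f. (\<forall>l\<le>d. \<forall>v\<in>rok_box n. positive_contraction UNIV (f l v)) \<and>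
      (\<forall>l\<le>d. \<forall>v\<in>rok_box n. \<forall>u. norm (\<sigma> u (f l v) - f l (rok_mod n (v + u))) < \<epsilon>) \<and>
      (\<forall>l\<le>d. \<forall>v\<in>rok_box n. \<forall>v'\<in>rok_box n. v \<noteq> v' \<longrightarrow> norm (f l v * f l v') < \<epsilon>) \<and>
      (\<forall>l\<le>d. \<forall>v\<in>rok_box n. \<forall>a\<in>F. norm (f l v * a - a * f l v) < \<epsilon>) \<and>
      norm ((\<Sum>l\<le>d. \<Sum>v\<in>rok_box n. f l v) - 1) < \<epsilon>"
  proof (intro exI[of _ "\<lambda>l v. \<sigma> w (f l v)"] conjI allI impI ballI)
    fix l v assume "l \<le> d" "v \<in> (rok_box n :: (int ^ 'm) set)"
    then show "positive_contraction UNIV (\<sigma> w (f l v))"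
      using pos positive_contraction_star_automorphism[OF aut] by blast
  next
    fix l v u assume "l \<le> d" "v \<in> (rok_box n :: (int ^ 'm) set)"
    then show "norm (\<sigma> u (\<sigma> w (f l v)) - \<sigma> w (f l (rok_mod n (v + u)))) < \<epsilon>"
      using equi less by (simp add: comm flip: additive.diff[OF add])
  next
    fix l v v' assume "l \<le> d" "v \<in> rok_box n" "v' \<in> rok_box n" "v \<noteq> (v' :: int ^ 'm)"
    then show "norm (\<sigma> w (f l v) * \<sigma> w (f l v')) < \<epsilon>"
      using orth less by (simp flip: mult)
  next
    fix l v a assume "l \<le> d" "v \<in> (rok_box n :: (int ^ 'm) set)" "a \<in> F"
    then show "norm (\<sigma> w (f l v) * a - a * \<sigma> w (f l v)) < \<epsilon>" using w by simp
  next
    have "\<sigma> w ((\<Sum>l\<le>d. \<Sum>v\<in>rok_box n. f l v) - 1) = (\<Sum>l\<le>d. \<Sum>v\<in>rok_box n. \<sigma> w (f l v)) - 1"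
      by (simp add: additive.diff[OF add] additive.sum[OF add] star_automorphism_one[OF aut])
    then show "norm ((\<Sum>l\<le>d. \<Sum>v\<in>rok_box n. \<sigma> w (f l v)) - 1) < \<epsilon>"
      using less[OF unit] by simp
  qed
qed

theorem corollary6p4:
  fixes B :: "'a::unital_cstar_algebra set"
    and \<tau> :: "(int ^ 'm::finite \<Rightarrow> 'a) \<Rightarrow> 'c::unital_cstar_algebra"
    and \<sigma> :: "int ^ 'm \<Rightarrow> 'c \<Rightarrow> 'c"
  assumes "cstar_subalgebra B" and "1 \<in> B"
    and "is_infinite_tensor \<tau>"
    and "is_bernoulli_action \<tau> \<sigma>"
  shows "rokhlin_dim UNIV \<sigma> \<le> rokhlin_dim (infinite_tensor \<tau> B) \<sigma>"
  unfolding rokhlin_dim_def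
  using rokhlin_dim_le_UNIV[OF assms(3,4)] by (intro Inf_superset_mono) blast

end
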